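(* For every $\mathsf{SKS}$ derivation $\Phi$ there exists a super-streamlined $\mathsf{SKS}$ derivation with the same premiss and the same conclusion as $\Phi$.
   Context: Formulae are built from the units $\mathsf f$ (false) and $\mathsf t$ (true), atoms $a,b,\dots$, disjunction $[\alpha\vee\beta]$ and conjunction $(\alpha\wedge\beta)$; on atoms there is an involution $a\mapsto\bar a$ with $\bar a\neq a$ (negation only applies to atoms). A context $\xi\{\ \}$ is a formula with a hole. An inference step of a rule $\alpha/\beta$ (premiss $\alpha$ above, conclusion $\beta$ below) rewrites $\xi\{\alpha\}$ into $\xi\{\beta\}$ for an arbitrary context $\xi$ (deep inference). A derivation from $\alpha$ (premiss) to $\beta$ (conclusion) is a finite chain of inference steps starting at $\alpha$ and ending at $\beta$; a proof is a derivation with premiss $\mathsf t$. System $\mathsf{SKS}$ consists of: interaction $\mathsf{ai}{\downarrow}$: $\mathsf t/[a\vee\bar a]$; weakening $\mathsf{aw}{\downarrow}$: $\mathsf f/a$; contraction $\mathsf{ac}{\downarrow}$: $[a\vee a]/a$; cointeraction or cut $\mathsf{ai}{\uparrow}$: $(a\wedge\bar a)/\mathsf f$; coweakening $\mathsf{aw}{\uparrow}$: $a/\mathsf t$; cocontraction $\mathsf{ac}{\uparrow}$: $a/(a\wedge a)$ (for every atom $a$); switch $(\alpha\wedge[\beta\vee\gamma])/[(\alpha\wedge\beta)\vee\gamma]$; medial $[(\alpha\wedge\beta)\vee(\gamma\wedge\delta)]/([\alpha\vee\gamma]\wedge[\beta\vee\delta])$; and the rule $\gamma/\delta$ whenever $\gamma=\delta$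 is (either direction of) an instance of: commutativity and associativity of $\vee$ and $\wedge$, $[\alpha\vee\mathsf f]=\alpha$, $(\alpha\wedge\mathsf t)=\alpha$, $[\mathsf t\vee\mathsf t]=\mathsf t$, $(\mathsf f\wedge\mathsf f)=\mathsf f$. An atomic flow is a tuple $(V,E,\eta,up,lo)$: finite sets $V$ (vertices) and $E$ (edges), a labelling $\eta$ of vertices by one of interaction ($\mathsf{ai}{\downarrow}$), cut ($\mathsf{ai}{\uparrow}$), weakening ($\mathsf{aw}{\downarrow}$), coweakening ($\mathsf{aw}{\uparrow}$), contraction ($\mathsf{ac}{\downarrow}$), cocontraction ($\mathsf{ac}{\uparrow}$), and maps $up:E\to V\cup\{\top\}$, $lo:E\to V\cup\{\bot\}$ ($\top,\bot\notin V$). The upper edges of a vertex $\nu$ are those $\epsilon$ with $lo(\epsilon)=\nu$, its lower edges those with $up(\epsilon)=\nu$. The (number of upper, number of lower) edges must be $(0,2)$ for interaction, $(2,0)$ for cut, $(0,1)$ for weakening, $(1,0)$ for coweakening, $(2,1)$ for contraction, $(1,2)$ for cocontraction; the directed graph has no directed cycle; and there is a map $\pi:E\to\{+,-\}$ such that all edges of each (co)contraction vertex get the same sign and the two edges of each interaction or cut vertex get different signs. Flows are considered up to isomorphism. The atomic flow associated with an $\mathsf{SKS}$ derivation $\Phi$ is obtained by tracing atom occurrences: each atom occurrence of $\Phi$ is mapped to an edge; in every inference step, occurrences in the context and (for switch, medial and $=$) in the subformulae instantiating $\alpha,\beta,\gamma,\delta$ are mapped to the same edges in the step's premiss and conclusion;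 each step of one of the six atomic (structural) rules gives a vertex labelled by that rule, whose upper edges are the atom occurrences of the redex in the step's premiss and whose lower edges are the atom occurrences of the redex in the step's conclusion; occurrences in the premiss of $\Phi$ are edges with $up=\top$ and those in the conclusion edges with $lo=\bot$. An $\mathsf{SKS}$ derivation is streamlined if in its associated atomic flow there is no directed path (sequence of edges $\epsilon_1,\dots,\epsilon_h$ with $lo(\epsilon_i)=up(\epsilon_{i+1})$) from an interaction or weakening vertex to a cut or coweakening vertex. It is super-streamlined if it is streamlined and its atomic flow is normal (no reduction applies) for the following weakening reductions on flows, each of which replaces a subgraph: (i) a weakening whose lower edge is an upper edge of a contraction: delete both and merge the contraction's other upper edge with its lower edge into one edge; (ii) dually, a coweakening whose upper edge is a lower edge of a cocontraction: delete both and merge the cocontraction's upper edge with its other lower edge; (iii) a weakening whose lower edge is an upper edge of a cut: delete both and make the cut's other upper edge the upper edge of a new coweakening; (iv) dually, an interaction one of whose lower edges is the upper edge of a coweakening: delete both and make the other lower edge the lower edge of a new weakening; (v) an edge from a weakening to a coweakening: delete it and both vertices; (vi) a weakening whose lower edge is the upper edge of a cocontraction: replace by two weakenings whose lower edges are the cocontraction's two lower edges; (vii) dually, a coweakening whose upper edge is the lower edge of a contraction: replace by two coweakenings whose upper edges are the contraction's two upper edges. *)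

theory Defs
  imports Main
begin

text \<open>Atoms are pairs (name, polarity); the involution flips the polarity.
  This is a fixed-point-free involution, and every such involution is of this form.\<close>
type_synonym 'a atom = "'a \<times> bool"

definition dual :: "'a atom \<Rightarrow> 'a atom" where
  "dual a = (fst a, \<not> snd a)"

datatype 'a fm = FF | TT | At "'a atom" | Or "'a fm" "'a fm" | And "'a fm" "'a fm"

text \<open>Positions in a formula: paths, False = left argument, True = right argument.\<close>
type_synonym pos = "bool list"

fun atom_pos :: "'a fm \<Rightarrow> pos set" where
  "atom_pos (At a) = {[]}"
| "atom_pos (Or l r) = (Cons False) ` atom_pos l \<union> (Cons True) ` atom_pos r"
| "atom_pos (And l r) = (Cons False) ` atom_pos l \<union> (Cons True) ` atom_pos r"
| "atom_pos _ = {}"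

datatype 'a ctx = Hole | OrL "'a ctx" "'a fm" | OrR "'a fm" "'a ctx"
  | AndL "'a ctx" "'a fm" | AndR "'a fm" "'a ctx"

fun fill :: "'a ctx \<Rightarrow> 'a fm \<Rightarrow> 'a fm" where
  "fill Hole x = x"
| "fill (OrL c r) x = Or (fill c x) r"
| "fill (OrR l c) x = Or l (fill c x)"
| "fill (AndL c r) x = And (fill c x) r"
| "fill (AndR l c) x = And l (fill c x)"

fun hole_path :: "'a ctx \<Rightarrow> pos" where
  "hole_path Hole = []"
| "hole_path (OrL c r) = False # hole_path c"
| "hole_path (OrR l c) = True # hole_path c"
| "hole_path (AndL c r) = False # hole_path c"
| "hole_path (AndR l c) = True # hole_path c"

datatype 'a eqn =
    CommOr "'a fm" "'a fm"
  | CommAnd "'a fm" "'a fm"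
  | AssocOr "'a fm" "'a fm" "'a fm"
  | AssocAnd "'a fm" "'a fm" "'a fm"
  | UnitOr "'a fm"
  | UnitAnd "'a fm"
  | TTOr
  | FFAnd

fun eq_lhs :: "'a eqn \<Rightarrow> 'a fm" where
  "eq_lhs (CommOr a b) = Or a b"
| "eq_lhs (CommAnd a b) = And a b"
| "eq_lhs (AssocOr a b c) = Or (Or a b) c"
| "eq_lhs (AssocAnd a b c) = And (And a b) c"
| "eq_lhs (UnitOr a) = Or a FF"
| "eq_lhs (UnitAnd a) = And a TT"
| "eq_lhs TTOr = Or TT TT"
| "eq_lhs FFAnd = And FF FF"

fun eq_rhs :: "'a eqn \<Rightarrow> 'a fm" where
  "eq_rhs (CommOr a b) = Or b a"
| "eq_rhs (CommAnd a b) = And b a"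
| "eq_rhs (AssocOr a b c) = Or a (Or b c)"
| "eq_rhs (AssocAnd a b c) = And a (And b c)"
| "eq_rhs (UnitOr a) = a"
| "eq_rhs (UnitAnd a) = a"
| "eq_rhs TTOr = TT"
| "eq_rhs FFAnd = FF"

text \<open>Positions of the instantiated metavariables: pairs (position in lhs, position in rhs).\<close>
fun eq_vars :: "'a eqn \<Rightarrow> (pos \<times> pos) list" where
  "eq_vars (CommOr a b) = [([False],[True]), ([True],[False])]"
| "eq_vars (CommAnd a b) = [([False],[True]), ([True],[False])]"
| "eq_vars (AssocOr a b c) = [([False,False],[False]), ([False,True],[True,False]), ([True],[True,True])]"
| "eq_vars (AssocAnd a b c) = [([False,False],[False]), ([False,True],[True,False]), ([True],[True,True])]"
| "eq_vars (UnitOr a) = [([False],[])]"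
| "eq_vars (UnitAnd a) = [([False],[])]"
| "eq_vars TTOr = []"
| "eq_vars FFAnd = []"

text \<open>Rule instances. \<open>Eqn e True\<close> rewrites lhs to rhs, \<open>Eqn e False\<close> rhs to lhs.\<close>
datatype 'a rinst =
    AiD "'a atom" | AwD "'a atom" | AcD "'a atom"
  | AiU "'a atom" | AwU "'a atom" | AcU "'a atom"
  | Switch "'a fm" "'a fm" "'a fm"
  | Medial "'a fm" "'a fm" "'a fm" "'a fm"
  | Eqn "'a eqn" bool

fun rprem :: "'a rinst \<Rightarrow> 'a fm" where
  "rprem (AiD a) = TT"
| "rprem (AwD a) = FF"
| "rprem (AcD a) = Or (At a) (At a)"
| "rprem (AiU a) = And (At a) (At (dual a))"
| "rprem (AwU a) = At a"
| "rprem (AcU a) = At a"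
| "rprem (Switch a b c) = And a (Or b c)"
| "rprem (Medial a b c d) = Or (And a b) (And c d)"
| "rprem (Eqn e d) = (if d then eq_lhs e else eq_rhs e)"

fun rconcl :: "'a rinst \<Rightarrow> 'a fm" where
  "rconcl (AiD a) = Or (At a) (At (dual a))"
| "rconcl (AwD a) = At a"
| "rconcl (AcD a) = At a"
| "rconcl (AiU a) = FF"
| "rconcl (AwU a) = TT"
| "rconcl (AcU a) = And (At a) (At a)"
| "rconcl (Switch a b c) = Or (And a b) c"
| "rconcl (Medial a b c d) = And (Or a c) (Or b d)"
| "rconcl (Eqn e d) = (if d then eq_rhs e else eq_lhs e)"

text \<open>Metavariable positions (position in premiss, position in conclusion) for the
  non-atomic rules (switch, medial, equations).\<close>
fun rvars :: "'a rinst \<Rightarrow> (pos \<times> pos) list" where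
  "rvars (Switch a b c) = [([False],[False,False]), ([True,False],[False,True]), ([True,True],[True])]"
| "rvars (Medial a b c d) = [([False,False],[False,False]), ([False,True],[True,False]),
                             ([True,False],[False,True]), ([True,True],[True,True])]"
| "rvars (Eqn e d) = (if d then eq_vars e else map (\<lambda>(x,y). (y,x)) (eq_vars e))"
| "rvars _ = []"

datatype kind = KAiD | KAwD | KAcD | KAiU | KAwU | KAcU

fun rkind :: "'a rinst \<Rightarrow> kind option" where
  "rkind (AiD a) = Some KAiD"
| "rkind (AwD a) = Some KAwD"
| "rkind (AcD a) = Some KAcD"
| "rkind (AiU a) = Some KAiU"
| "rkind (AwU a) = Some KAwU"
| "rkind (AcU a) = Some KAcU"
| "rkind _ = None"

definition is_atomic :: "'a rinst \<Rightarrow> bool" where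
  "is_atomic r \<longleftrightarrow> rkind r \<noteq> None"

text \<open>Tracing an atom occurrence in the conclusion of a non-atomic rule instance back to
  its occurrence in the premiss.\<close>
definition back_pos :: "'a rinst \<Rightarrow> pos \<Rightarrow> pos" where
  "back_pos r q = (case find (\<lambda>(pp, pc). take (length pc) q = pc) (rvars r) of
       Some (pp, pc) \<Rightarrow> pp @ drop (length pc) q
     | None \<Rightarrow> q)"

type_synonym 'a step = "'a ctx \<times> 'a rinst"

fun derivation :: "'a fm \<Rightarrow> 'a step list \<Rightarrow> 'a fm \<Rightarrow> bool" where
  "derivation A [] B \<longleftrightarrow> A = B"
| "derivation A ((c, r) # s) B \<longleftrightarrow> A = fill c (rprem r) \<and> derivation (fill c (rconcl r)) s B"

text \<open>An atomic flow: vertices, edges, labelling, and the maps up, lo, where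
  \<open>None\<close> stands for the top (for up) resp. bottom (for lo) boundary.\<close>
record ('v, 'e) flow =
  fverts :: "'v set"
  fedges :: "'e set"
  flab :: "'v \<Rightarrow> kind"
  fup :: "'e \<Rightarrow> 'v option"
  flo :: "'e \<Rightarrow> 'v option"

inductive dpath :: "('v, 'e) flow \<Rightarrow> 'v \<Rightarrow> 'v \<Rightarrow> bool" for G where
  one: "e \<in> fedges G \<Longrightarrow> fup G e = Some v \<Longrightarrow> flo G e = Some w \<Longrightarrow> dpath G v w"
| more: "dpath G v u \<Longrightarrow> e \<in> fedges G \<Longrightarrow> fup G e = Some u \<Longrightarrow> flo G e = Some w \<Longrightarrow> dpath G v w"

definition streamlined_flow :: "('v, 'e) flow \<Rightarrow> bool" where
  "streamlined_flow G \<longleftrightarrow>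
     (\<forall>v\<in>fverts G. \<forall>w\<in>fverts G.
        flab G v \<in> {KAiD, KAwD} \<and> flab G w \<in> {KAiU, KAwU} \<longrightarrow> \<not> dpath G v w)"

definition edge_between :: "('v, 'e) flow \<Rightarrow> 'e \<Rightarrow> kind \<Rightarrow> kind \<Rightarrow> bool" where
  "edge_between G e k1 k2 \<longleftrightarrow> e \<in> fedges G \<and>
     (\<exists>v w. fup G e = Some v \<and> flo G e = Some w \<and> v \<in> fverts G \<and> w \<in> fverts G
            \<and> flab G v = k1 \<and> flab G w = k2)"

text \<open>Normality w.r.t. the weakening reductions (i)-(vii): none of their redexes occurs.\<close>
definition weak_normal :: "('v, 'e) flow \<Rightarrow> bool" where
  "weak_normal G \<longleftrightarrow> (\<forall>e.
       \<not> edge_between G e KAwD KAcD      \<comment> \<open>(i)\<close>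
     \<and> \<not> edge_between G e KAcU KAwU      \<comment> \<open>(ii)\<close>
     \<and> \<not> edge_between G e KAwD KAiU      \<comment> \<open>(iii)\<close>
     \<and> \<not> edge_between G e KAiD KAwU      \<comment> \<open>(iv)\<close>
     \<and> \<not> edge_between G e KAwD KAwU      \<comment> \<open>(v)\<close>
     \<and> \<not> edge_between G e KAwD KAcU      \<comment> \<open>(vi)\<close>
     \<and> \<not> edge_between G e KAcD KAwU)    \<comment> \<open>(vii)\<close>"

text \<open>Vertices are indices of steps of atomic rules. Edges are identified by their
  lower end: \<open>UpE j q\<close> is the upper edge of vertex j at position q of the premiss of the
  redex; \<open>FinE p\<close> is the edge of the atom occurrence at position p of the conclusion.\<close>
datatype edge = UpE nat pos | FinE pos

text \<open>\<open>trace s k p\<close>: the upper end of the edge of the atom occurrence at position p of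
  the k-th formula of the derivation (formula 0 is the premiss); None means the top.\<close>
fun trace :: "'a step list \<Rightarrow> nat \<Rightarrow> pos \<Rightarrow> nat option" where
  "trace s 0 p = None"
| "trace s (Suc k) p =
     (let c = fst (s ! k); r = snd (s ! k); h = hole_path c in
      if take (length h) p = h then
        (if is_atomic r then Some k
         else trace s k (h @ back_pos r (drop (length h) p)))
      else trace s k p)"

definition flow_of :: "'a step list \<Rightarrow> 'a fm \<Rightarrow> (nat, edge) flow" where
  "flow_of s B =
    \<lparr> fverts = {j. j < length s \<and> is_atomic (snd (s ! j))},
      fedges = {UpE j q | j q. j < length s \<and> is_atomic (snd (s ! j)) \<and> q \<in> atom_pos (rprem (snd (s ! j)))}
               \<union> {FinE p | p. p \<in> atom_pos B},
      flab = (\<lambda>j. the (rkind (snd (s ! j)))),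
      fup = (\<lambda>e. case e of UpE j q \<Rightarrow> trace s j (hole_path (fst (s ! j)) @ q)
                         | FinE p \<Rightarrow> trace s (length s) p),
      flo = (\<lambda>e. case e of UpE j q \<Rightarrow> Some j | FinE p \<Rightarrow> None) \<rparr>"

definition streamlined :: "'a step list \<Rightarrow> 'a fm \<Rightarrow> bool" where
  "streamlined s B \<longleftrightarrow> streamlined_flow (flow_of s B)"

definition super_streamlined :: "'a step list \<Rightarrow> 'a fm \<Rightarrow> bool" where
  "super_streamlined s B \<longleftrightarrow> streamlined s B \<and> weak_normal (flow_of s B)"

end

theory Submission
  imports Defs "HOL-Library.Multiset"
begin

text \<open>By soundness, \<open>A\<close> classically implies \<open>B\<close>, so \<open>A\<close> and \<open>\<not>B\<close> are jointly
  unsatisfiable. Replace atom occurrences of \<open>A\<close> and of \<open>\<not>B\<close> by \<open>t\<close> for as long as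
  this keeps the pair unsatisfiable, obtaining \<open>F\<close> and \<open>H\<close> in which every atom occurrence
  is needed. For every clause \<open>c\<close> of the disjunctive normal form of \<open>F\<close> and \<open>d\<close> of \<open>H\<close>
  there is then a clash: a complementary pair of atoms in \<open>c\<close>, in \<open>d\<close>, or across \<open>c\<close>
  and \<open>d\<close>. Using only cocontraction and cut (plus switch, medial and the equations), \<open>F\<close>
  derives \<open>\<Or>\<^sub>c \<And>\<^sub>d P\<^sub>c\<^sub>d\<close>, where \<open>P\<^sub>c\<^sub>d\<close> is \<open>f\<close>, \<open>t\<close>, or the \<open>F\<close>-atom of a crossing
  clash; as every atom occurrence of \<open>F\<close> takes part in some clash, no coweakening is
  needed here. By duality \<open>\<And>\<^sub>d \<Or>\<^sub>c P\<^sub>c\<^sub>d\<close> derives \<open>\<not>H\<close> with interaction and contraction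
  only, and medials connect the two matrices. The resulting derivation performs its atomic
  steps in the order coweakening, cut/cocontraction, interaction/contraction, weakening.
  Edges of its atomic flow point forward in the derivation, so there is no path from an
  interaction or weakening to a cut or coweakening, and no weakening redex.\<close>

section \<open>Derivability with a restricted set of atomic rules\<close>

definition step_kinds :: "'a step list \<Rightarrow> kind set" where
  "step_kinds s = {k. \<exists>x\<in>set s. rkind (snd x) = Some k}"

definition derivable :: "kind set \<Rightarrow> 'a fm \<Rightarrow> 'a fm \<Rightarrow> bool" where
  "derivable K A B \<longleftrightarrow> (\<exists>s. derivation A s B \<and> step_kinds s \<subseteq> K)"

lemma derivation_append:
  "derivation A (s @ t) C \<longleftrightarrow> (\<exists>B. derivation A s B \<and> derivation B t C)"
  by (induction s arbitrary: A) auto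

lemma step_kinds_append [simp]: "step_kinds (s @ t) = step_kinds s \<union> step_kinds t"
  unfolding step_kinds_def by auto

lemma derivable_refl [simp]: "derivable K A A"
  unfolding derivable_def by (rule exI[of _ "[]"]) (auto simp: step_kinds_def)

lemma derivable_trans [trans]: "derivable K A B \<Longrightarrow> derivable K B C \<Longrightarrow> derivable K A C"
  unfolding derivable_def by (metis derivation_append step_kinds_append le_sup_iff)

lemma derivable_mono: "derivable K A B \<Longrightarrow> K \<subseteq> L \<Longrightarrow> derivable L A B"
  unfolding derivable_def by blast

fun ctx_comp :: "'a ctx \<Rightarrow> 'a ctx \<Rightarrow> 'a ctx" where
  "ctx_comp Hole d = d"
| "ctx_comp (OrL c r) d = OrL (ctx_comp c d) r"
| "ctx_comp (OrR l c) d = OrR l (ctx_comp c d)"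
| "ctx_comp (AndL c r) d = AndL (ctx_comp c d) r"
| "ctx_comp (AndR l c) d = AndR l (ctx_comp c d)"

lemma fill_ctx_comp [simp]: "fill (ctx_comp c d) x = fill c (fill d x)"
  by (induction c) auto

lemma derivable_fill:
  assumes "derivable K A B"
  shows "derivable K (fill c A) (fill c B)"
proof -
  let ?lift = "map (\<lambda>(d, r). (ctx_comp c d, r))"
  have "derivation (fill c A') (?lift s) (fill c B')" if "derivation A' s B'" for A' s B'
    using that by (induction s arbitrary: A') auto
  moreover have "step_kinds (?lift s) = step_kinds s" for s
    unfolding step_kinds_def by (force split: prod.splits)
  ultimately show ?thesis
    using assms unfolding derivable_def by metis
qed

lemma derivable_rule: "(\<And>k. rkind r = Some k \<Longrightarrow> k \<in> K) \<Longrightarrow> derivable K (rprem r) (rconcl r)"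
  unfolding derivable_def by (rule exI[of _ "[(Hole, r)]"]) (auto simp: step_kinds_def)

lemma derivable_OrL: "derivable K A B \<Longrightarrow> derivable K (Or A C) (Or B C)"
  using derivable_fill[of K A B "OrL Hole C"] by simp
lemma derivable_OrR: "derivable K A B \<Longrightarrow> derivable K (Or C A) (Or C B)"
  using derivable_fill[of K A B "OrR C Hole"] by simp
lemma derivable_AndL: "derivable K A B \<Longrightarrow> derivable K (And A C) (And B C)"
  using derivable_fill[of K A B "AndL Hole C"] by simp
lemma derivable_AndR: "derivable K A B \<Longrightarrow> derivable K (And C A) (And C B)"
  using derivable_fill[of K A B "AndR C Hole"] by simp

lemma derivable_Or: "derivable K A A' \<Longrightarrow> derivable K B B' \<Longrightarrow> derivable K (Or A B) (Or A' B')"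
  by (meson derivable_OrL derivable_OrR derivable_trans)
lemma derivable_And: "derivable K A A' \<Longrightarrow> derivable K B B' \<Longrightarrow> derivable K (And A B) (And A' B')"
  by (meson derivable_AndL derivable_AndR derivable_trans)

lemma derivable_eqn: "derivable K (eq_lhs e) (eq_rhs e)"
  using derivable_rule[of "Eqn e True" K] by simp
lemma derivable_eqn_rev: "derivable K (eq_rhs e) (eq_lhs e)"
  using derivable_rule[of "Eqn e False" K] by simp

lemma derivable_Or_comm: "derivable K (Or a b) (Or b a)"
  using derivable_eqn[of K "CommOr a b"] by simp
lemma derivable_And_comm: "derivable K (And a b) (And b a)"
  using derivable_eqn[of K "CommAnd a b"] by simp
lemma derivable_Or_assoc: "derivable K (Or (Or a b) c) (Or a (Or b c))"
  using derivable_eqn[of K "AssocOr a b c"] by simp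
lemma derivable_And_assoc: "derivable K (And (And a b) c) (And a (And b c))"
  using derivable_eqn[of K "AssocAnd a b c"] by simp
lemma derivable_And_assoc_rev: "derivable K (And a (And b c)) (And (And a b) c)"
  using derivable_eqn_rev[of K "AssocAnd a b c"] by simp
lemma derivable_Or_FF: "derivable K (Or a FF) a"
  using derivable_eqn[of K "UnitOr a"] by simp
lemma derivable_Or_FF_rev: "derivable K a (Or a FF)"
  using derivable_eqn_rev[of K "UnitOr a"] by simp
lemma derivable_And_TT: "derivable K (And a TT) a"
  using derivable_eqn[of K "UnitAnd a"] by simp
lemma derivable_And_TT_rev: "derivable K a (And a TT)"
  using derivable_eqn_rev[of K "UnitAnd a"] by simp
lemma derivable_TT_Or_TT: "derivable K (Or TT TT) TT"
  using derivable_eqn[of K "TTOr"] by simp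
lemma derivable_FF_And_FF: "derivable K (And FF FF) FF"
  using derivable_eqn[of K "FFAnd"] by simp
lemma derivable_FF_And_FF_rev: "derivable K FF (And FF FF)"
  using derivable_eqn_rev[of K "FFAnd"] by simp
lemma derivable_FF_Or: "derivable K (Or FF a) a"
  by (meson derivable_Or_comm derivable_Or_FF derivable_trans)
lemma derivable_FF_Or_rev: "derivable K a (Or FF a)"
  by (meson derivable_Or_comm derivable_Or_FF_rev derivable_trans)
lemma derivable_TT_And: "derivable K (And TT a) a"
  by (meson derivable_And_comm derivable_And_TT derivable_trans)
lemma derivable_TT_And_rev: "derivable K a (And TT a)"
  by (meson derivable_And_comm derivable_And_TT_rev derivable_trans)

lemma derivable_switch: "derivable K (And a (Or b c)) (Or (And a b) c)"
  using derivable_rule[of "Switch a b c" K] by simp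
lemma derivable_medial: "derivable K (Or (And a b) (And c d)) (And (Or a c) (Or b d))"
  using derivable_rule[of "Medial a b c d" K] by simp

lemma derivable_FF_TT: "derivable K FF TT"
proof -
  have "derivable K FF (And FF TT)" by (rule derivable_And_TT_rev)
  also have "derivable K \<dots> (And FF (Or FF TT))" by (rule derivable_AndR, rule derivable_FF_Or_rev)
  also have "derivable K \<dots> (Or (And FF FF) TT)" by (rule derivable_switch)
  also have "derivable K \<dots> (Or FF TT)" by (rule derivable_OrL, rule derivable_FF_And_FF)
  also have "derivable K \<dots> TT" by (rule derivable_FF_Or)
  finally show ?thesis .
qed

fun conjs :: "'a fm list \<Rightarrow> 'a fm" where
  "conjs [] = TT"
| "conjs (x # xs) = And x (conjs xs)"

fun disjs :: "'a fm list \<Rightarrow> 'a fm" where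
  "disjs [] = FF"
| "disjs (x # xs) = Or x (disjs xs)"

lemma conjs_append: "derivable K (conjs (xs @ ys)) (And (conjs xs) (conjs ys))"
proof (induction xs)
  case Nil then show ?case by (simp add: derivable_TT_And_rev)
next
  case (Cons x xs)
  have "derivable K (And x (conjs (xs @ ys))) (And x (And (conjs xs) (conjs ys)))"
    using Cons by (rule derivable_AndR)
  also have "derivable K \<dots> (And (And x (conjs xs)) (conjs ys))" by (rule derivable_And_assoc_rev)
  finally show ?case by simp
qed

lemma conjs_append_rev: "derivable K (And (conjs xs) (conjs ys)) (conjs (xs @ ys))"
proof (induction xs)
  case Nil then show ?case by (simp add: derivable_TT_And)
next
  case (Cons x xs)
  have "derivable K (And (And x (conjs xs)) (conjs ys)) (And x (And (conjs xs) (conjs ys)))"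
    by (rule derivable_And_assoc)
  also have "derivable K \<dots> (And x (conjs (xs @ ys)))" using Cons by (rule derivable_AndR)
  finally show ?case by simp
qed

lemma disjs_append_rev: "derivable K (Or (disjs xs) (disjs ys)) (disjs (xs @ ys))"
proof (induction xs)
  case Nil then show ?case by (simp add: derivable_FF_Or)
next
  case (Cons x xs)
  have "derivable K (Or (Or x (disjs xs)) (disjs ys)) (Or x (Or (disjs xs) (disjs ys)))"
    by (rule derivable_Or_assoc)
  also have "derivable K \<dots> (Or x (disjs (xs @ ys)))" using Cons by (rule derivable_OrR)
  finally show ?case by simp
qed

lemma conjs_concat: "derivable K (conjs (concat xss)) (conjs (map conjs xss))"
proof (induction xss)
  case (Cons xs xss)
  have "derivable K (conjs (xs @ concat xss)) (And (conjs xs) (conjs (concat xss)))"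
    by (rule conjs_append)
  also have "derivable K \<dots> (And (conjs xs) (conjs (map conjs xss)))"
    using Cons by (rule derivable_AndR)
  finally show ?case by simp
qed simp

lemma disjs_concat: "derivable K (disjs (map disjs xss)) (disjs (concat xss))"
proof (induction xss)
  case (Cons xs xss)
  have "derivable K (Or (disjs xs) (disjs (map disjs xss))) (Or (disjs xs) (disjs (concat xss)))"
    using Cons by (rule derivable_OrR)
  also have "derivable K \<dots> (disjs (xs @ concat xss))" by (rule disjs_append_rev)
  finally show ?case by simp
qed simp

lemma conjs_map:
  "(\<And>x. x \<in> set xs \<Longrightarrow> derivable K (f x) (g x)) \<Longrightarrow>
   derivable K (conjs (map f xs)) (conjs (map g xs))"
  by (induction xs) (auto intro: derivable_And)

lemma disjs_map:
  "(\<And>x. x \<in> set xs \<Longrightarrow> derivable K (f x) (g x)) \<Longrightarrow>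
   derivable K (disjs (map f xs)) (disjs (map g xs))"
  by (induction xs) (auto intro: derivable_Or)

lemma derivable_And_And_swap: "derivable K (And (And a b) (And c d)) (And (And a c) (And b d))"
proof -
  have "derivable K (And (And a b) (And c d)) (And a (And b (And c d)))"
    by (rule derivable_And_assoc)
  also have "derivable K \<dots> (And a (And (And b c) d))"
    by (rule derivable_AndR, rule derivable_And_assoc_rev)
  also have "derivable K \<dots> (And a (And (And c b) d))"
    by (rule derivable_AndR, rule derivable_AndL, rule derivable_And_comm)
  also have "derivable K \<dots> (And a (And c (And b d)))"
    by (rule derivable_AndR, rule derivable_And_assoc)
  also have "derivable K \<dots> (And (And a c) (And b d))" by (rule derivable_And_assoc_rev)
  finally show ?thesis .
qed

lemma conjs_perm: "mset xs = mset ys \<Longrightarrow> derivable K (conjs xs) (conjs ys)"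
proof (induction xs arbitrary: ys)
  case (Cons x xs)
  then have "x \<in> set ys" by (metis list.set_intros(1) set_mset_mset)
  then obtain ys1 ys2 where ys: "ys = ys1 @ x # ys2" by (meson split_list)
  with Cons.prems have m: "mset xs = mset (ys1 @ ys2)" by simp
  have "derivable K (And x (conjs xs)) (And x (conjs (ys1 @ ys2)))"
    using Cons.IH[OF m] by (rule derivable_AndR)
  also have "derivable K \<dots> (And x (And (conjs ys1) (conjs ys2)))"
    by (rule derivable_AndR, rule conjs_append)
  also have "derivable K \<dots> (And (And x (conjs ys1)) (conjs ys2))" by (rule derivable_And_assoc_rev)
  also have "derivable K \<dots> (And (And (conjs ys1) x) (conjs ys2))"
    by (rule derivable_AndL, rule derivable_And_comm)
  also have "derivable K \<dots> (And (conjs ys1) (And x (conjs ys2)))" by (rule derivable_And_assoc)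
  also have "derivable K \<dots> (conjs (ys1 @ x # ys2))" using conjs_append_rev[of K ys1 "x # ys2"] by simp
  finally show ?case using ys by simp
qed simp

lemma conjs_medial:
  "derivable K (Or (conjs (map f ds)) (conjs (map g ds))) (conjs (map (\<lambda>d. Or (f d) (g d)) ds))"
proof (induction ds)
  case Nil then show ?case by (simp add: derivable_TT_Or_TT)
next
  case (Cons d ds)
  have "derivable K (Or (And (f d) (conjs (map f ds))) (And (g d) (conjs (map g ds))))
      (And (Or (f d) (g d)) (Or (conjs (map f ds)) (conjs (map g ds))))" by (rule derivable_medial)
  also have "derivable K \<dots> (And (Or (f d) (g d)) (conjs (map (\<lambda>d. Or (f d) (g d)) ds)))"
    using Cons by (rule derivable_AndR)
  finally show ?case by simp
qed

lemma conjs_And: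
  "derivable K (And (conjs (map f ds)) (conjs (map g ds))) (conjs (map (\<lambda>d. And (f d) (g d)) ds))"
proof (induction ds)
  case Nil then show ?case by (simp add: derivable_And_TT)
next
  case (Cons d ds)
  have "derivable K (And (And (f d) (conjs (map f ds))) (And (g d) (conjs (map g ds))))
      (And (And (f d) (g d)) (And (conjs (map f ds)) (conjs (map g ds))))"
    by (rule derivable_And_And_swap)
  also have "derivable K \<dots> (And (And (f d) (g d)) (conjs (map (\<lambda>d. And (f d) (g d)) ds)))"
    using Cons by (rule derivable_AndR)
  finally show ?case by simp
qed

lemma disjs_conjs_switch:
  "derivable K (And (disjs (map f ds)) (conjs (map g ds))) (disjs (map (\<lambda>d. And (f d) (g d)) ds))"
proof (induction ds)
  case Nil then show ?case by (simp add: derivable_And_TT)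
next
  case (Cons d ds)
  let ?X = "disjs (map f ds)" and ?Y = "conjs (map g ds)"
  have "derivable K (And (Or (f d) ?X) (And (g d) ?Y)) (And (And (g d) ?Y) (Or (f d) ?X))"
    by (rule derivable_And_comm)
  also have "derivable K \<dots> (And (And ?Y (g d)) (Or (f d) ?X))"
    by (rule derivable_AndL, rule derivable_And_comm)
  also have "derivable K \<dots> (And ?Y (And (g d) (Or (f d) ?X)))" by (rule derivable_And_assoc)
  also have "derivable K \<dots> (And ?Y (Or (And (g d) (f d)) ?X))"
    by (rule derivable_AndR, rule derivable_switch)
  also have "derivable K \<dots> (And ?Y (Or ?X (And (g d) (f d))))"
    by (rule derivable_AndR, rule derivable_Or_comm)
  also have "derivable K \<dots> (Or (And ?Y ?X) (And (g d) (f d)))" by (rule derivable_switch)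
  also have "derivable K \<dots> (Or (And (g d) (f d)) (And ?Y ?X))" by (rule derivable_Or_comm)
  also have "derivable K \<dots> (Or (And (f d) (g d)) (And ?X ?Y))"
    by (rule derivable_Or; rule derivable_And_comm)
  also have "derivable K \<dots> (Or (And (f d) (g d)) (disjs (map (\<lambda>d. And (f d) (g d)) ds)))"
    using Cons by (rule derivable_OrR)
  finally show ?case by simp
qed

lemma FF_conjs: "derivable K FF (conjs (map (\<lambda>_. FF) ds))"
proof (induction ds)
  case Nil then show ?case by (simp add: derivable_FF_TT)
next
  case (Cons d ds)
  show ?case using derivable_trans[OF derivable_FF_And_FF_rev derivable_AndR[OF Cons.IH]] by simp
qed

lemma TT_conjs: "derivable K TT (conjs (map (\<lambda>_. TT) ds))"
proof (induction ds)
  case (Cons d ds)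
  show ?case using derivable_trans[OF derivable_And_TT_rev derivable_AndR[OF Cons.IH]] by simp
qed simp

lemma disjs_conjs_medial:
  "derivable K (disjs (map (\<lambda>c. conjs (map (\<lambda>d. P c d) ds)) cs))
               (conjs (map (\<lambda>d. disjs (map (\<lambda>c. P c d) cs)) ds))"
proof (induction cs)
  case Nil then show ?case using FF_conjs[of K ds] by simp
next
  case (Cons c cs)
  have "derivable K (Or (conjs (map (P c) ds)) (disjs (map (\<lambda>c. conjs (map (P c) ds)) cs)))
     (Or (conjs (map (P c) ds)) (conjs (map (\<lambda>d. disjs (map (\<lambda>c. P c d) cs)) ds)))"
    using Cons by (rule derivable_OrR)
  also have "derivable K \<dots> (conjs (map (\<lambda>d. Or (P c d) (disjs (map (\<lambda>c. P c d) cs))) ds))"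
    by (rule conjs_medial)
  finally show ?case by simp
qed

lemma dual_dual [simp]: "dual (dual a) = a"
  by (cases a) (simp add: dual_def)

fun eval_atom :: "('a \<Rightarrow> bool) \<Rightarrow> 'a atom \<Rightarrow> bool" where
  "eval_atom v (x, b) \<longleftrightarrow> v x = b"

lemma eval_atom_dual [simp]: "eval_atom v (dual a) \<longleftrightarrow> \<not> eval_atom v a"
  by (cases a) (auto simp: dual_def)

fun eval :: "('a \<Rightarrow> bool) \<Rightarrow> 'a fm \<Rightarrow> bool" where
  "eval v FF \<longleftrightarrow> False"
| "eval v TT \<longleftrightarrow> True"
| "eval v (At a) \<longleftrightarrow> eval_atom v a"
| "eval v (Or l r) \<longleftrightarrow> eval v l \<or> eval v r"
| "eval v (And l r) \<longleftrightarrow> eval v l \<and> eval v r"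

definition jointly_sat :: "'a fm \<Rightarrow> 'a fm \<Rightarrow> bool" where
  "jointly_sat F H \<longleftrightarrow> (\<exists>v. eval v F \<and> eval v H)"

lemma jointly_sat_sym: "jointly_sat F H \<longleftrightarrow> jointly_sat H F"
  unfolding jointly_sat_def by blast

fun atom_at :: "'a fm \<Rightarrow> pos \<Rightarrow> 'a atom" where
  "atom_at (At a) [] = a"
| "atom_at (Or l r) (b # p) = (if b then atom_at r p else atom_at l p)"
| "atom_at (And l r) (b # p) = (if b then atom_at r p else atom_at l p)"
| "atom_at _ _ = undefined"

lemma finite_atom_pos: "finite (atom_pos F)"
  by (induction F) auto

text \<open>The disjunctive normal form of a formula, each clause given by the positions of its
  atoms.\<close>

fun clauses :: "'a fm \<Rightarrow> pos list list" where
  "clauses FF = []"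
| "clauses TT = [[]]"
| "clauses (At a) = [[[]]]"
| "clauses (Or l r) = map (map (Cons False)) (clauses l) @ map (map (Cons True)) (clauses r)"
| "clauses (And l r) =
     concat (map (\<lambda>c1. map (\<lambda>c2. map (Cons False) c1 @ map (Cons True) c2) (clauses r)) (clauses l))"

lemma eval_clauses:
  "eval v F \<longleftrightarrow> (\<exists>c\<in>set (clauses F). \<forall>p\<in>set c. eval_atom v (atom_at F p))"
proof (induction F)
  case (Or l r)
  then show ?case by (auto simp: bex_Un)
next
  case (And l r)
  show ?case
  proof
    assume "eval v (And l r)"
    then obtain c1 c2 where "c1 \<in> set (clauses l)" "\<forall>p\<in>set c1. eval_atom v (atom_at l p)"
      "c2 \<in> set (clauses r)" "\<forall>p\<in>set c2. eval_atom v (atom_at r p)"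
      using And by auto
    then show "\<exists>c\<in>set (clauses (And l r)). \<forall>p\<in>set c. eval_atom v (atom_at (And l r) p)"
      by (intro bexI[of _ "map (Cons False) c1 @ map (Cons True) c2"]) auto
  next
    assume "\<exists>c\<in>set (clauses (And l r)). \<forall>p\<in>set c. eval_atom v (atom_at (And l r) p)"
    then obtain c1 c2 where "c1 \<in> set (clauses l)" "c2 \<in> set (clauses r)"
      and c: "\<forall>p\<in>set (map (Cons False) c1 @ map (Cons True) c2). eval_atom v (atom_at (And l r) p)"
      by auto
    moreover have "\<forall>p\<in>set c1. eval_atom v (atom_at l p)" "\<forall>p\<in>set c2. eval_atom v (atom_at r p)"
      using bspec[OF c, of "False # _"] bspec[OF c, of "True # _"] by auto
    ultimately show "eval v (And l r)" using And by auto
  qed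
qed auto

lemma clauses_subset_atom_pos: "c \<in> set (clauses F) \<Longrightarrow> set c \<subseteq> atom_pos F"
  by (induction F arbitrary: c) fastforce+

fun coweaken :: "'a fm \<Rightarrow> pos set \<Rightarrow> 'a fm" where
  "coweaken (At a) P = (if [] \<in> P then TT else At a)"
| "coweaken (Or l r) P = Or (coweaken l {p. False # p \<in> P}) (coweaken r {p. True # p \<in> P})"
| "coweaken (And l r) P = And (coweaken l {p. False # p \<in> P}) (coweaken r {p. True # p \<in> P})"
| "coweaken FF P = FF"
| "coweaken TT P = TT"

lemma atom_pos_coweaken: "atom_pos (coweaken F P) = atom_pos F - P"
  by (induction F arbitrary: P) auto

lemma atom_at_coweaken: "p \<in> atom_pos F - P \<Longrightarrow> atom_at (coweaken F P) p = atom_at F p"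
  by (induction F arbitrary: P p) auto

lemma clauses_coweaken: "clauses (coweaken F P) = map (filter (\<lambda>p. p \<notin> P)) (clauses F)"
proof (induction F arbitrary: P)
  case (And l r)
  show ?case by (simp add: And comp_def filter_map map_concat)
qed (auto simp: comp_def filter_map)

lemma size_coweaken: "size (coweaken F P) \<le> size F"
  by (induction F arbitrary: P) (auto simp: add_mono)

lemma derivable_coweaken: "KAwU \<in> K \<Longrightarrow> derivable K F (coweaken F P)"
proof (induction F arbitrary: P)
  case (At a)
  have "derivable K (At a) TT" using derivable_rule[of "AwU a" K] At.prems by simp
  then show ?case by simp
qed (auto intro: derivable_Or derivable_And)

lemma eval_fill_mono: "(eval v x \<longrightarrow> eval v y) \<Longrightarrow> eval v (fill c x) \<Longrightarrow> eval v (fill c y)"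
  by (induction c) auto

lemma eval_rule: "eval v (rprem r) \<Longrightarrow> eval v (rconcl r)"
proof -
  have "eval v (eq_lhs e) = eval v (eq_rhs e)" for e
    by (cases e) auto
  then show "eval v (rprem r) \<Longrightarrow> eval v (rconcl r)"
    by (cases r) (auto split: if_splits)
qed

lemma derivation_sound: "derivation A s B \<Longrightarrow> eval v A \<Longrightarrow> eval v B"
proof (induction s arbitrary: A)
  case (Cons st s)
  obtain c r where "st = (c, r)" by fastforce
  then show ?case
    using Cons eval_fill_mono[of v "rprem r" "rconcl r" c] eval_rule by auto
qed simp

section \<open>Duality\<close>

fun neg :: "'a fm \<Rightarrow> 'a fm" where
  "neg FF = TT"
| "neg TT = FF"
| "neg (At a) = At (dual a)"
| "neg (Or l r) = And (neg l) (neg r)"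
| "neg (And l r) = Or (neg l) (neg r)"

lemma neg_neg [simp]: "neg (neg F) = F"
  by (induction F) auto

lemma eval_neg [simp]: "eval v (neg F) \<longleftrightarrow> \<not> eval v F"
  by (induction F) auto

lemma neg_conjs: "neg (conjs xs) = disjs (map neg xs)"
  by (induction xs) auto

lemma neg_disjs: "neg (disjs xs) = conjs (map neg xs)"
  by (induction xs) auto

fun dual_kind :: "kind \<Rightarrow> kind" where
  "dual_kind KAiD = KAiU" | "dual_kind KAwD = KAwU" | "dual_kind KAcD = KAcU"
| "dual_kind KAiU = KAiD" | "dual_kind KAwU = KAwD" | "dual_kind KAcU = KAcD"

fun neg_ctx :: "'a ctx \<Rightarrow> 'a ctx" where
  "neg_ctx Hole = Hole"
| "neg_ctx (OrL c r) = AndL (neg_ctx c) (neg r)"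
| "neg_ctx (OrR l c) = AndR (neg l) (neg_ctx c)"
| "neg_ctx (AndL c r) = OrL (neg_ctx c) (neg r)"
| "neg_ctx (AndR l c) = OrR (neg l) (neg_ctx c)"

lemma neg_fill: "neg (fill c x) = fill (neg_ctx c) (neg x)"
  by (induction c) auto

fun dual_eqn :: "'a eqn \<Rightarrow> 'a eqn" where
  "dual_eqn (CommOr a b) = CommAnd (neg a) (neg b)"
| "dual_eqn (CommAnd a b) = CommOr (neg a) (neg b)"
| "dual_eqn (AssocOr a b c) = AssocAnd (neg a) (neg b) (neg c)"
| "dual_eqn (AssocAnd a b c) = AssocOr (neg a) (neg b) (neg c)"
| "dual_eqn (UnitOr a) = UnitAnd (neg a)"
| "dual_eqn (UnitAnd a) = UnitOr (neg a)"
| "dual_eqn TTOr = FFAnd"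
| "dual_eqn FFAnd = TTOr"

lemma neg_eq_lhs: "neg (eq_lhs e) = eq_lhs (dual_eqn e)"
  by (cases e) auto

lemma neg_eq_rhs: "neg (eq_rhs e) = eq_rhs (dual_eqn e)"
  by (cases e) auto

lemma derivable_dual_rule:
  "derivable (dual_kind ` {k. rkind r = Some k}) (neg (rconcl r)) (neg (rprem r))"
  (is "derivable ?K _ _")
proof (cases r)
  case (AiD a)
  then show ?thesis using derivable_rule[of "AiU (dual a)" ?K] by auto
next
  case (AwD a)
  then show ?thesis using derivable_rule[of "AwU (dual a)" ?K] by auto
next
  case (AcD a)
  then show ?thesis using derivable_rule[of "AcU (dual a)" ?K] by auto
next
  case (AiU a)
  have "derivable ?K TT (Or (At (dual a)) (At a))"
    using derivable_rule[of "AiD (dual a)" ?K] AiU by auto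
  then show ?thesis using AiU by simp
next
  case (AwU a)
  then show ?thesis using derivable_rule[of "AwD (dual a)" ?K] by auto
next
  case (AcU a)
  then show ?thesis using derivable_rule[of "AcD (dual a)" ?K] by auto
next
  case (Switch a b c)
  have "derivable ?K (And (Or (neg a) (neg b)) (neg c)) (And (neg c) (Or (neg b) (neg a)))"
    by (meson derivable_And_comm derivable_AndR derivable_Or_comm derivable_trans)
  also have "derivable ?K \<dots> (Or (And (neg c) (neg b)) (neg a))" by (rule derivable_switch)
  also have "derivable ?K \<dots> (Or (neg a) (And (neg b) (neg c)))"
    by (meson derivable_And_comm derivable_OrR derivable_Or_comm derivable_trans)
  finally show ?thesis using Switch by simp
next
  case (Medial a b c d)
  then show ?thesis using derivable_medial[of ?K "neg a" "neg c" "neg b" "neg d"] by simp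
next
  case (Eqn e d)
  then show ?thesis
    by (cases d) (auto simp: neg_eq_lhs neg_eq_rhs derivable_eqn derivable_eqn_rev)
qed

lemma derivable_dual:
  assumes "derivable K A B"
  shows "derivable (dual_kind ` K) (neg B) (neg A)"
proof -
  have "derivable (dual_kind ` K) (neg B) (neg A)" if "derivation A s B" "step_kinds s \<subseteq> K" for s
    using that
  proof (induction s arbitrary: A)
    case (Cons st s)
    obtain c r where st: "st = (c, r)" by fastforce
    with Cons.prems have A: "A = fill c (rprem r)" and s: "derivation (fill c (rconcl r)) s B"
      and k: "{k. rkind r = Some k} \<subseteq> K" "step_kinds s \<subseteq> K" by (auto simp: step_kinds_def)
    have "derivable (dual_kind ` K) (neg B) (neg (fill c (rconcl r)))" using Cons.IH s k by blast
    also have "derivable (dual_kind ` K) \<dots> (neg (fill c (rprem r)))"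
      unfolding neg_fill
      by (rule derivable_fill, rule derivable_mono[OF derivable_dual_rule]) (use k in blast)
    finally show ?case using A by simp
  qed simp
  then show ?thesis using assms unfolding derivable_def by blast
qed

section \<open>Cocontraction into selected clauses\<close>

lemma list_all2_right_in_set: "list_all2 P xs ys \<Longrightarrow> y \<in> set ys \<Longrightarrow> \<exists>x\<in>set xs. P x y"
  by (metis in_set_conv_nth list_all2_conv_all_nth)

lemma list_all2_concat_map_left:
  "list_all2 P (concat (map f xs)) N \<Longrightarrow>
   \<exists>NN. N = concat NN \<and> list_all2 (\<lambda>x row. list_all2 P (f x) row) xs NN"
proof (induction xs arbitrary: N)
  case (Cons x xs)
  then obtain us vs where "N = us @ vs" "list_all2 P (f x) us" "list_all2 P (concat (map f xs)) vs"
    by (auto simp: list_all2_append1)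
  with Cons.IH[of vs] show ?case
    by (metis concat.simps(2) list.rel_intros(2))
qed simp

lemma At_cocontract_copies:
  assumes "\<exists>S\<in>set Ss. [] \<in> S" "KAcU \<in> K"
  shows "derivable K (At a) (conjs (map (\<lambda>S. if [] \<in> S then At a else TT) Ss))"
  using assms(1)
proof (induction Ss)
  case (Cons S Ss)
  have copy: "derivable K (At a) (And (At a) (At a))"
    using derivable_rule[of "AcU a" K] assms(2) by simp
  show ?case
  proof (cases "\<exists>S\<in>set Ss. [] \<in> S")
    case True
    then show ?thesis
      using derivable_trans[OF copy derivable_AndR[OF Cons.IH]]
        derivable_trans[OF derivable_TT_And_rev derivable_AndR[OF Cons.IH]] by simp
  next
    case False
    then have "[] \<in> S" and TTs: "map (\<lambda>S. if [] \<in> S then At a else TT) Ss = map (\<lambda>_. TT) Ss"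
      using Cons.prems by auto
    moreover have "derivable K (At a) (And (At a) (conjs (map (\<lambda>_. TT) Ss)))"
      by (rule derivable_trans[OF derivable_And_TT_rev derivable_AndR[OF TT_conjs]])
    ultimately show ?thesis by (simp only: list.map conjs.simps TTs if_True)
  qed
qed simp

lemma cocontract_split:
  "atom_pos F \<subseteq> \<Union>(set Ss) \<Longrightarrow> KAcU \<in> K \<Longrightarrow>
   derivable K F (conjs (map (\<lambda>S. coweaken F (- S)) Ss))"
proof (induction F arbitrary: Ss)
  case FF then show ?case using FF_conjs[of K Ss] by simp
next
  case TT then show ?case using TT_conjs[of K Ss] by simp
next
  case (At a)
  then have ex: "\<exists>S\<in>set Ss. [] \<in> S" by auto
  have eq: "map (\<lambda>S. coweaken (At a) (- S)) Ss = map (\<lambda>S. if [] \<in> S then At a else TT) Ss"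
    by auto
  show ?case unfolding eq by (rule At_cocontract_copies[OF ex At.prems(2)])
next
  case (Or l r)
  have "atom_pos l \<subseteq> \<Union>(set (map (\<lambda>S. {p. False # p \<in> S}) Ss))"
    using Or.prems(1) by auto
  from Or.IH(1)[OF this Or.prems(2)]
  have left: "derivable K l (conjs (map (\<lambda>S. coweaken l (- {p. False # p \<in> S})) Ss))"
    by (simp add: comp_def)
  have "atom_pos r \<subseteq> \<Union>(set (map (\<lambda>S. {p. True # p \<in> S}) Ss))"
    using Or.prems(1) by auto
  from Or.IH(2)[OF this Or.prems(2)]
  have right: "derivable K r (conjs (map (\<lambda>S. coweaken r (- {p. True # p \<in> S})) Ss))"
    by (simp add: comp_def)
  show ?case
    using derivable_trans[OF derivable_Or[OF left right] conjs_medial] by (simp add: Collect_neg_eq)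
next
  case (And l r)
  have "atom_pos l \<subseteq> \<Union>(set (map (\<lambda>S. {p. False # p \<in> S}) Ss))"
    using And.prems(1) by auto
  from And.IH(1)[OF this And.prems(2)]
  have left: "derivable K l (conjs (map (\<lambda>S. coweaken l (- {p. False # p \<in> S})) Ss))"
    by (simp add: comp_def)
  have "atom_pos r \<subseteq> \<Union>(set (map (\<lambda>S. {p. True # p \<in> S}) Ss))"
    using And.prems(1) by auto
  from And.IH(2)[OF this And.prems(2)]
  have right: "derivable K r (conjs (map (\<lambda>S. coweaken r (- {p. True # p \<in> S})) Ss))"
    by (simp add: comp_def)
  show ?case
    using derivable_trans[OF derivable_And[OF left right] conjs_And] by (simp add: Collect_neg_eq)
qed

lemma At_cocontract_replicate:
  "n \<noteq> [] \<Longrightarrow> KAcU \<in> K \<Longrightarrow> derivable K (At a) (conjs (map (\<lambda>_. At a) n))"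
proof (induction n)
  case (Cons x n)
  show ?case
  proof (cases "n = []")
    case True then show ?thesis by (simp add: derivable_And_TT_rev)
  next
    case False
    have "derivable K (At a) (And (At a) (At a))"
      using derivable_rule[of "AcU a" K] Cons.prems(2) by simp
    then show ?thesis
      using derivable_trans[OF _ derivable_AndR[OF Cons.IH[OF False Cons.prems(2)]]] by simp
  qed
qed simp

definition clause_fm :: "'a fm \<Rightarrow> pos list \<Rightarrow> 'a fm" where
  "clause_fm F n = conjs (map (\<lambda>p. At (atom_at F p)) n)"

definition clause_selection :: "'a fm \<Rightarrow> pos list list \<Rightarrow> bool" where
  "clause_selection F N \<longleftrightarrow>
     list_all2 (\<lambda>c n. set n \<subseteq> set c) (clauses F) N \<and> (\<forall>p\<in>atom_pos F. \<exists>n\<in>set N. p \<in> set n)"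

definition branch_pos :: "bool \<Rightarrow> pos list \<Rightarrow> pos list" where
  "branch_pos b n = map tl (filter (\<lambda>p. hd p = b) n)"

lemma branch_pos_subset:
  "set n \<subseteq> set (map (Cons False) c1 @ map (Cons True) c2) \<Longrightarrow>
   set (branch_pos False n) \<subseteq> set c1 \<and> set (branch_pos True n) \<subseteq> set c2"
  unfolding branch_pos_def by auto

lemma in_branch_pos: "b # p \<in> set n \<Longrightarrow> p \<in> set (branch_pos b n)"
  unfolding branch_pos_def by force

lemma mset_branch_pos:
  "\<forall>p\<in>set n. p \<noteq> [] \<Longrightarrow>
   mset n = mset (map (Cons False) (branch_pos False n) @ map (Cons True) (branch_pos True n))"
proof (induction n)
  case (Cons p n)
  then obtain b q where "p = b # q" by (cases p) auto
  then show ?case using Cons by (cases b) (auto simp: branch_pos_def)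
qed (simp add: branch_pos_def)

lemma clause_fm_Or_tl:
  "\<forall>p\<in>set n. \<exists>q. p = b # q \<Longrightarrow> clause_fm (Or l r) n = clause_fm (if b then r else l) (map tl n)"
  unfolding clause_fm_def by (induction n) auto

lemma clause_fm_And_map_Cons:
  "clause_fm (And l r) (map (Cons b) n) = clause_fm (if b then r else l) n"
  unfolding clause_fm_def by (induction n) auto

lemma clause_fm_append: "derivable K (And (clause_fm F xs) (clause_fm F ys)) (clause_fm F (xs @ ys))"
  unfolding clause_fm_def using conjs_append_rev[of K "map (\<lambda>p. At (atom_at F p)) xs"] by simp

lemma clause_fm_concat: "derivable K (clause_fm F (concat xs)) (conjs (map (clause_fm F) xs))"
  unfolding clause_fm_def map_concat
  using conjs_concat[of K "map (map (\<lambda>p. At (atom_at F p))) xs"] by (simp add: comp_def)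

lemma clause_fm_perm: "mset xs = mset ys \<Longrightarrow> derivable K (clause_fm F xs) (clause_fm F ys)"
  unfolding clause_fm_def by (rule conjs_perm) simp

lemma clause_selection_map_tl:
  assumes "list_all2 (\<lambda>c n. set n \<subseteq> set c) (map (map (Cons b)) (clauses X)) N"
    and "\<forall>p\<in>atom_pos X. \<exists>n\<in>set N. b # p \<in> set n"
  shows "clause_selection X (map (map tl) N)"
  unfolding clause_selection_def
proof
  show "list_all2 (\<lambda>c n. set n \<subseteq> set c) (clauses X) (map (map tl) N)"
    using assms(1) unfolding list_all2_map1 list_all2_map2 by (rule list_all2_mono) auto
  show "\<forall>p\<in>atom_pos X. \<exists>n\<in>set (map (map tl) N). p \<in> set n"
    using assms(2) by force
qed

lemma cocontract_selection_Or:
  assumes IHl: "\<And>N. clause_selection l N \<Longrightarrow> derivable K l (disjs (map (clause_fm l) N))"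
    and IHr: "\<And>N. clause_selection r N \<Longrightarrow> derivable K r (disjs (map (clause_fm r) N))"
    and sel: "clause_selection (Or l r) N"
  shows "derivable K (Or l r) (disjs (map (clause_fm (Or l r)) N))"
proof -
  let ?P = "\<lambda>c n. set n \<subseteq> set c"
  from sel obtain N1 N2 where N: "N = N1 @ N2"
    and a1: "list_all2 ?P (map (map (Cons False)) (clauses l)) N1"
    and a2: "list_all2 ?P (map (map (Cons True)) (clauses r)) N2"
    unfolding clause_selection_def by (auto simp: list_all2_append1)
  have b1: "\<forall>n\<in>set N1. \<forall>p\<in>set n. \<exists>q. p = False # q"
    using a1 by (fastforce dest: list_all2_right_in_set)
  have b2: "\<forall>n\<in>set N2. \<forall>p\<in>set n. \<exists>q. p = True # q"
    using a2 by (fastforce dest: list_all2_right_in_set)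
  have "\<forall>p\<in>atom_pos l. \<exists>n\<in>set N1. False # p \<in> set n"
  proof
    fix p assume "p \<in> atom_pos l"
    then have "False # p \<in> atom_pos (Or l r)" by simp
    then obtain n where n: "n \<in> set N" "False # p \<in> set n"
      using sel unfolding clause_selection_def by blast
    moreover have "n \<notin> set N2" using b2 n(2) by fastforce
    ultimately show "\<exists>n\<in>set N1. False # p \<in> set n" using N by auto
  qed
  with a1 have left: "clause_selection l (map (map tl) N1)"
    by (rule clause_selection_map_tl)
  have "\<forall>p\<in>atom_pos r. \<exists>n\<in>set N2. True # p \<in> set n"
  proof
    fix p assume "p \<in> atom_pos r"
    then have "True # p \<in> atom_pos (Or l r)" by simp
    then obtain n where n: "n \<in> set N" "True # p \<in> set n"
      using sel unfolding clause_selection_def by blast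
    moreover have "n \<notin> set N1" using b1 n(2) by fastforce
    ultimately show "\<exists>n\<in>set N2. True # p \<in> set n" using N by auto
  qed
  with a2 have right: "clause_selection r (map (map tl) N2)"
    by (rule clause_selection_map_tl)
  have eq_l: "map (clause_fm l) (map (map tl) N1) = map (clause_fm (Or l r)) N1"
    unfolding map_map comp_def using b1 clause_fm_Or_tl[of _ False l r] by (intro map_cong) auto
  have eq_r: "map (clause_fm r) (map (map tl) N2) = map (clause_fm (Or l r)) N2"
    unfolding map_map comp_def using b2 clause_fm_Or_tl[of _ True l r] by (intro map_cong) auto
  show ?thesis
    using derivable_trans[OF derivable_Or[OF IHl[OF left] IHr[OF right]] disjs_append_rev]
    unfolding eq_l eq_r N by simp
qed

lemma row_branch_pos:
  assumes "list_all2 (\<lambda>c n. set n \<subseteq> set c)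
      (map (\<lambda>c2. map (Cons False) c1 @ map (Cons True) c2) (clauses r)) row"
    and "n \<in> set row"
  shows "set (branch_pos True n) \<subseteq> atom_pos r" "\<forall>p\<in>set n. p \<noteq> []"
proof -
  obtain c2 where "c2 \<in> set (clauses r)" "set n \<subseteq> set (map (Cons False) c1 @ map (Cons True) c2)"
    using list_all2_right_in_set[OF assms] by auto
  then show "set (branch_pos True n) \<subseteq> atom_pos r" "\<forall>p\<in>set n. p \<noteq> []"
    using branch_pos_subset[of n c1 c2] clauses_subset_atom_pos[of c2 r] by auto
qed

lemma clause_fm_And_branches:
  assumes "\<forall>p\<in>set n. p \<noteq> []"
  shows "derivable K (And (clause_fm r (branch_pos True n)) (clause_fm l (branch_pos False n)))
    (clause_fm (And l r) n)"
proof -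
  let ?nl = "branch_pos False n" and ?nr = "branch_pos True n"
  have "derivable K (And (clause_fm r ?nr) (clause_fm l ?nl)) (And (clause_fm l ?nl) (clause_fm r ?nr))"
    by (rule derivable_And_comm)
  also have "derivable K \<dots> (clause_fm (And l r) (map (Cons False) ?nl @ map (Cons True) ?nr))"
    using clause_fm_append[of K "And l r" "map (Cons False) ?nl" "map (Cons True) ?nr"]
    by (simp add: clause_fm_And_map_Cons)
  also have "derivable K \<dots> (clause_fm (And l r) n)"
    by (rule clause_fm_perm) (use mset_branch_pos assms in auto)
  finally show ?thesis .
qed

lemma cocontract_selection_And_row:
  assumes IHr: "\<And>P N. clause_selection (coweaken r P) N \<Longrightarrow>
      derivable K (coweaken r P) (disjs (map (clause_fm (coweaken r P)) N))"
    and row: "list_all2 (\<lambda>c n. set n \<subseteq> set c)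
      (map (\<lambda>c2. map (Cons False) c1 @ map (Cons True) c2) (clauses r)) row"
  defines "S \<equiv> \<Union>n\<in>set row. set (branch_pos True n)"
  shows "derivable K (And (conjs (map (\<lambda>n. clause_fm l (branch_pos False n)) row)) (coweaken r (- S)))
    (disjs (map (clause_fm (And l r)) row))"
proof -
  let ?W = "coweaken r (- S)" and ?L = "conjs (map (\<lambda>n. clause_fm l (branch_pos False n)) row)"
  have "clause_selection ?W (map (branch_pos True) row)"
    unfolding clause_selection_def clauses_coweaken list_all2_map1 list_all2_map2
  proof
    show "list_all2 (\<lambda>c n. set (branch_pos True n) \<subseteq> set (filter (\<lambda>p. p \<notin> - S) c)) (clauses r) row"
      using row unfolding list_all2_map1
      by (rule list.rel_mono_strong) (use branch_pos_subset in \<open>force simp: S_def\<close>)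
    show "\<forall>p\<in>atom_pos ?W. \<exists>n\<in>set (map (branch_pos True) row). p \<in> set n"
      unfolding atom_pos_coweaken S_def by auto
  qed
  then have IH: "derivable K ?W (disjs (map (clause_fm ?W) (map (branch_pos True) row)))"
    by (rule IHr)
  have W_eq: "map (clause_fm ?W) (map (branch_pos True) row) = map (\<lambda>n. clause_fm r (branch_pos True n)) row"
    unfolding map_map comp_def
  proof (rule map_cong[OF refl])
    fix n assume "n \<in> set row"
    then have sub: "set (branch_pos True n) \<subseteq> atom_pos r - - S"
      using row_branch_pos(1)[OF row] unfolding S_def by auto
    show "clause_fm ?W (branch_pos True n) = clause_fm r (branch_pos True n)"
      unfolding clause_fm_def
      by (intro arg_cong[where f=conjs] map_cong refl) (metis sub atom_at_coweaken subsetD)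
  qed
  have "derivable K (And ?L ?W) (And ?L (disjs (map (\<lambda>n. clause_fm r (branch_pos True n)) row)))"
    using IH unfolding W_eq by (rule derivable_AndR)
  also have "derivable K \<dots> (And (disjs (map (\<lambda>n. clause_fm r (branch_pos True n)) row)) ?L)"
    by (rule derivable_And_comm)
  also have "derivable K \<dots>
      (disjs (map (\<lambda>n. And (clause_fm r (branch_pos True n)) (clause_fm l (branch_pos False n))) row))"
    by (rule disjs_conjs_switch)
  also have "derivable K \<dots> (disjs (map (clause_fm (And l r)) row))"
    by (rule disjs_map) (use row_branch_pos(2)[OF row] clause_fm_And_branches in blast)
  finally show ?thesis .
qed

lemma clause_selection_And_rows:
  assumes sel: "clause_selection (And l r) N"
  obtains NN where "N = concat NN"
    and "list_all2 (\<lambda>c1 row. list_all2 (\<lambda>c n. set n \<subseteq> set c)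
      (map (\<lambda>c2. map (Cons False) c1 @ map (Cons True) c2) (clauses r)) row) (clauses l) NN"
    and "clause_selection l (map (\<lambda>row. concat (map (branch_pos False) row)) NN)"
    and "atom_pos r \<subseteq> (\<Union>row\<in>set NN. \<Union>n\<in>set row. set (branch_pos True n))"
proof -
  let ?P = "\<lambda>c n. set n \<subseteq> set c"
  have "list_all2 ?P (concat (map (\<lambda>c1. map (\<lambda>c2. map (Cons False) c1 @ map (Cons True) c2)
      (clauses r)) (clauses l))) N"
    using sel unfolding clause_selection_def by simp
  from list_all2_concat_map_left[OF this] obtain NN where N: "N = concat NN"
    and rows: "list_all2 (\<lambda>c1 row. list_all2 ?P
      (map (\<lambda>c2. map (Cons False) c1 @ map (Cons True) c2) (clauses r)) row) (clauses l) NN"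
    by blast
  have "clause_selection l (map (\<lambda>row. concat (map (branch_pos False) row)) NN)"
    unfolding clause_selection_def
  proof
    show "list_all2 ?P (clauses l) (map (\<lambda>row. concat (map (branch_pos False) row)) NN)"
      using rows unfolding list_all2_map2
      by (rule list_all2_mono) (fastforce dest: list_all2_right_in_set branch_pos_subset)
    show "\<forall>p\<in>atom_pos l. \<exists>n\<in>set (map (\<lambda>row. concat (map (branch_pos False) row)) NN). p \<in> set n"
    proof
      fix p assume "p \<in> atom_pos l"
      then have "False # p \<in> atom_pos (And l r)" by simp
      then obtain n where n: "n \<in> set N" "False # p \<in> set n"
        using sel unfolding clause_selection_def by blast
      then obtain row where "row \<in> set NN" "n \<in> set row" using N by auto
      then show "\<exists>n\<in>set (map (\<lambda>row. concat (map (branch_pos False) row)) NN). p \<in> set n"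
        using in_branch_pos[OF n(2)] by force
    qed
  qed
  moreover have "atom_pos r \<subseteq> (\<Union>row\<in>set NN. \<Union>n\<in>set row. set (branch_pos True n))"
  proof
    fix p assume "p \<in> atom_pos r"
    then have "True # p \<in> atom_pos (And l r)" by simp
    then obtain n where n: "n \<in> set N" "True # p \<in> set n"
      using sel unfolding clause_selection_def by blast
    then obtain row where "row \<in> set NN" "n \<in> set row" using N by auto
    then show "p \<in> (\<Union>row\<in>set NN. \<Union>n\<in>set row. set (branch_pos True n))"
      using in_branch_pos[OF n(2)] by blast
  qed
  ultimately show thesis using that N rows by blast
qed

text \<open>A selection for \<open>And l r\<close> falls into rows, one per clause of \<open>l\<close>. The left parts of
  all rows together form a selection for \<open>l\<close>, while \<open>r\<close> is split by cocontraction into one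
  copy per row, which is then distributed over its row by switch.\<close>

lemma cocontract_selection_And:
  assumes IHl: "\<And>N. clause_selection l N \<Longrightarrow> derivable K l (disjs (map (clause_fm l) N))"
    and IHr: "\<And>P N. clause_selection (coweaken r P) N \<Longrightarrow>
      derivable K (coweaken r P) (disjs (map (clause_fm (coweaken r P)) N))"
    and K: "KAcU \<in> K"
    and sel: "clause_selection (And l r) N"
  shows "derivable K (And l r) (disjs (map (clause_fm (And l r)) N))"
proof -
  define S where "S row = (\<Union>n\<in>set row. set (branch_pos True n))" for row
  obtain NN where N: "N = concat NN"
    and rows: "list_all2 (\<lambda>c1 row. list_all2 (\<lambda>c n. set n \<subseteq> set c)
      (map (\<lambda>c2. map (Cons False) c1 @ map (Cons True) c2) (clauses r)) row) (clauses l) NN"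
    and sel_l: "clause_selection l (map (\<lambda>row. concat (map (branch_pos False) row)) NN)"
    and cover_r: "atom_pos r \<subseteq> (\<Union>row\<in>set NN. S row)"
    using clause_selection_And_rows[OF sel] unfolding S_def by blast
  let ?L = "\<lambda>row. conjs (map (\<lambda>n. clause_fm l (branch_pos False n)) row)"
  from IHl[OF sel_l]
  have "derivable K l (disjs (map (\<lambda>row. clause_fm l (concat (map (branch_pos False) row))) NN))"
    by (simp add: comp_def)
  also have "derivable K \<dots> (disjs (map ?L NN))"
  proof (rule disjs_map)
    fix row
    show "derivable K (clause_fm l (concat (map (branch_pos False) row))) (?L row)"
      using clause_fm_concat[of K l "map (branch_pos False) row"] by (simp add: comp_def)
  qed
  finally have left: "derivable K l (disjs (map ?L NN))" .
  from cover_r have "atom_pos r \<subseteq> \<Union>(set (map S NN))" by simp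
  from cocontract_split[OF this K]
  have right: "derivable K r (conjs (map (\<lambda>row. coweaken r (- S row)) NN))"
    by (simp add: comp_def)
  have "derivable K (And l r) (And (disjs (map ?L NN)) (conjs (map (\<lambda>row. coweaken r (- S row)) NN)))"
    by (rule derivable_And[OF left right])
  also have "derivable K \<dots> (disjs (map (\<lambda>row. And (?L row) (coweaken r (- S row))) NN))"
    by (rule disjs_conjs_switch)
  also have "derivable K \<dots> (disjs (map (\<lambda>row. disjs (map (clause_fm (And l r)) row)) NN))"
  proof (rule disjs_map)
    fix row assume "row \<in> set NN"
    then obtain c1 where "list_all2 (\<lambda>c n. set n \<subseteq> set c)
        (map (\<lambda>c2. map (Cons False) c1 @ map (Cons True) c2) (clauses r)) row"
      using list_all2_right_in_set[OF rows] by blast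
    from cocontract_selection_And_row[OF IHr this]
    show "derivable K (And (?L row) (coweaken r (- S row))) (disjs (map (clause_fm (And l r)) row))"
      unfolding S_def .
  qed
  also have "derivable K \<dots> (disjs (map (clause_fm (And l r)) N))"
    using disjs_concat[of K "map (map (clause_fm (And l r))) NN"] N by (simp add: comp_def map_concat)
  finally show ?thesis .
qed

lemma cocontract_selection:
  assumes "clause_selection F N" "KAcU \<in> K"
  shows "derivable K F (disjs (map (clause_fm F) N))"
  using assms(1)
proof (induction "size F" arbitrary: F N rule: less_induct)
  case less
  show ?case
  proof (cases F)
    case FF
    then show ?thesis using less.prems by (simp add: clause_selection_def)
  next
    case TT
    then obtain n where "N = [n]" "n = []"
      using less.prems by (auto simp: clause_selection_def list_all2_Cons1)
    then show ?thesis using TT by (simp add: clause_fm_def derivable_Or_FF_rev)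
  next
    case (At a)
    then obtain n where N: "N = [n]" and n: "set n \<subseteq> {[]}" "[] \<in> set n"
      using less.prems by (auto simp: clause_selection_def list_all2_Cons1)
    then have "clause_fm F n = conjs (map (\<lambda>_. At a) n)"
      unfolding clause_fm_def At by (intro arg_cong[where f=conjs] map_cong) auto
    moreover have "n \<noteq> []" using n by auto
    ultimately show ?thesis
      using N At derivable_trans[OF At_cocontract_replicate[OF _ assms(2)] derivable_Or_FF_rev] by simp
  next
    case (Or l r)
    have "derivable K l (disjs (map (clause_fm l) N'))" if "clause_selection l N'" for N'
      using less.hyps[OF _ that] Or by simp
    moreover have "derivable K r (disjs (map (clause_fm r) N'))" if "clause_selection r N'" for N'
      using less.hyps[OF _ that] Or by simp
    ultimately show ?thesis
      using cocontract_selection_Or less.prems Or by blast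
  next
    case (And l r)
    have "derivable K l (disjs (map (clause_fm l) N'))" if "clause_selection l N'" for N'
      using less.hyps[OF _ that] And by simp
    moreover have "derivable K (coweaken r P) (disjs (map (clause_fm (coweaken r P)) N'))"
      if "clause_selection (coweaken r P) N'" for P N'
      using less.hyps[OF _ that] size_coweaken[of r P] And by simp
    ultimately show ?thesis
      using cocontract_selection_And assms(2) less.prems And by blast
  qed
qed

section \<open>Rank-sorted derivations are super-streamlined\<close>

fun rank :: "kind \<Rightarrow> nat" where
  "rank KAwU = 0" | "rank KAiU = 1" | "rank KAcU = 1"
| "rank KAiD = 2" | "rank KAcD = 2" | "rank KAwD = 3"

definition rank_sorted :: "'a step list \<Rightarrow> bool" where
  "rank_sorted s \<longleftrightarrow> sorted_wrt (\<lambda>x y. \<forall>k k'.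
     rkind (snd x) = Some k \<longrightarrow> rkind (snd y) = Some k' \<longrightarrow> rank k \<le> rank k') s"

lemma trace_less: "trace s k p = Some j \<Longrightarrow> j < k"
proof (induction k arbitrary: p)
  case (Suc k)
  then show ?case by (auto simp: Let_def split: if_splits dest: Suc.IH)
qed simp

lemma dpath_flow_of_less: "dpath (flow_of s B) v w \<Longrightarrow> v < w"
proof (induction rule: dpath.induct)
  case (one e v w)
  then show ?case by (auto simp: flow_of_def trace_less split: edge.splits)
next
  case (more v u e w)
  then have "u < w" by (auto simp: flow_of_def trace_less split: edge.splits)
  then show ?case using more by simp
qed

lemma rank_sorted_super_streamlined:
  assumes "rank_sorted s"
  shows "super_streamlined s B"
proof -
  let ?G = "flow_of s B"
  have rank_le: "rank (flab ?G v) \<le> rank (flab ?G w)"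
    if "dpath ?G v w" "v \<in> fverts ?G" "w \<in> fverts ?G" for v w
    using assms dpath_flow_of_less[OF that(1)] that(2,3)
    unfolding rank_sorted_def sorted_wrt_iff_nth_less by (auto simp: flow_of_def is_atomic_def)
  have edge_rank: "rank k1 \<le> rank k2" if "edge_between ?G e k1 k2" for e k1 k2
    using that rank_le dpath.one unfolding edge_between_def by metis
  have "streamlined s B"
    unfolding streamlined_def streamlined_flow_def using rank_le by fastforce
  moreover have "weak_normal ?G"
    unfolding weak_normal_def by (auto dest: edge_rank)
  ultimately show ?thesis unfolding super_streamlined_def by blast
qed

lemma rank_sorted_const:
  assumes "step_kinds s \<subseteq> K" "\<forall>k\<in>K. rank k = r"
  shows "rank_sorted s"
proof -
  have "rank k = r" if "x \<in> set s" "rkind (snd x) = Some k" for x k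
    using that assms unfolding step_kinds_def by blast
  then have "\<forall>x\<in>set s. \<forall>y\<in>set s. \<forall>k k'.
      rkind (snd x) = Some k \<longrightarrow> rkind (snd y) = Some k' \<longrightarrow> rank k \<le> rank k'"
    by fastforce
  then show ?thesis
    unfolding rank_sorted_def by (induction s) auto
qed

lemma rank_sorted_append:
  assumes "rank_sorted s" "rank_sorted t" "step_kinds s \<subseteq> K" "step_kinds t \<subseteq> L"
    and "\<forall>k\<in>K. \<forall>l\<in>L. rank k \<le> rank l"
  shows "rank_sorted (s @ t)"
proof -
  have "rank k \<le> rank k'"
    if "x \<in> set s" "y \<in> set t" "rkind (snd x) = Some k" "rkind (snd y) = Some k'" for x y k k'
    using that assms(3-5) unfolding step_kinds_def by blast
  then show ?thesis
    using assms(1,2) unfolding rank_sorted_def sorted_wrt_append by blast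
qed

lemma super_streamlined_phases:
  assumes "derivable {KAwU} A F" "derivable {KAcU, KAiU} F M"
    and "derivable {KAcD, KAiD} M G" "derivable {KAwD} G B"
  shows "\<exists>s. derivation A s B \<and> super_streamlined s B"
proof -
  obtain s1 s2 s3 s4
    where d: "derivation A s1 F" "derivation F s2 M" "derivation M s3 G" "derivation G s4 B"
      and k: "step_kinds s1 \<subseteq> {KAwU}" "step_kinds s2 \<subseteq> {KAcU, KAiU}"
        "step_kinds s3 \<subseteq> {KAcD, KAiD}" "step_kinds s4 \<subseteq> {KAwD}"
    using assms unfolding derivable_def by metis
  have "derivation A (s1 @ s2 @ s3 @ s4) B"
    using d by (auto simp: derivation_append)
  moreover have "rank_sorted (s1 @ s2 @ s3 @ s4)"
  proof -
    have r: "rank_sorted s1" "rank_sorted s2" "rank_sorted s3" "rank_sorted s4"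
      using k by (auto intro!: rank_sorted_const)
    have "rank_sorted (s3 @ s4)"
      by (rule rank_sorted_append[OF r(3,4) k(3,4)]) auto
    then have "rank_sorted (s2 @ s3 @ s4)"
      by (rule rank_sorted_append[OF r(2) _ k(2), of _ "{KAcD, KAiD, KAwD}"]) (use k in auto)
    then show ?thesis
      by (rule rank_sorted_append[OF r(1) _ k(1), of _ "{KAcU, KAiU, KAcD, KAiD, KAwD}"]) (use k in auto)
  qed
  ultimately show ?thesis using rank_sorted_super_streamlined by blast
qed

section \<open>Clashes between irredundant formulae\<close>

datatype clash = Clash_Left pos pos | Clash_Right pos pos | Clash_Cross pos pos

fun is_clash :: "'a fm \<Rightarrow> 'a fm \<Rightarrow> pos list \<Rightarrow> pos list \<Rightarrow> clash \<Rightarrow> bool" where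
  "is_clash F H c d (Clash_Left x x') \<longleftrightarrow> x \<in> set c \<and> x' \<in> set c \<and> atom_at F x' = dual (atom_at F x)"
| "is_clash F H c d (Clash_Right y y') \<longleftrightarrow> y \<in> set d \<and> y' \<in> set d \<and> atom_at H y' = dual (atom_at H y)"
| "is_clash F H c d (Clash_Cross x y) \<longleftrightarrow> x \<in> set c \<and> y \<in> set d \<and> atom_at H y = dual (atom_at F x)"

fun clash_swap :: "clash \<Rightarrow> clash" where
  "clash_swap (Clash_Left x y) = Clash_Right x y"
| "clash_swap (Clash_Right x y) = Clash_Left x y"
| "clash_swap (Clash_Cross x y) = Clash_Cross y x"

lemma is_clash_swap: "is_clash F H c d w \<Longrightarrow> is_clash H F d c (clash_swap w)"
  by (cases w) auto

text \<open>The atoms of the left clause consumed by a clash, and what they are reduced to by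
  cut: a left clash is cut to \<open>f\<close>; a crossing clash keeps its left atom, to be cut later
  against its dual from the other side.\<close>

fun clash_pos :: "clash \<Rightarrow> pos list" where
  "clash_pos (Clash_Left x y) = [x, y]"
| "clash_pos (Clash_Right x y) = []"
| "clash_pos (Clash_Cross x y) = [x]"

fun clash_residue :: "'a fm \<Rightarrow> clash \<Rightarrow> 'a fm" where
  "clash_residue F (Clash_Left x y) = FF"
| "clash_residue F (Clash_Right x y) = TT"
| "clash_residue F (Clash_Cross x y) = At (atom_at F x)"

lemma clash_pos_subset: "is_clash F H c d w \<Longrightarrow> set (clash_pos w) \<subseteq> set c"
  by (cases w) auto

lemma neg_clash_residue_swap: "is_clash F H c d w \<Longrightarrow> neg (clash_residue H (clash_swap w)) = clash_residue F w"
  by (cases w) auto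

lemma derivable_clash_residue:
  assumes "is_clash F H c d w" "KAiU \<in> K"
  shows "derivable K (clause_fm F (clash_pos w)) (clash_residue F w)"
proof (cases w)
  case (Clash_Left x x')
  let ?a = "atom_at F x"
  have "derivable K (And (At ?a) (And (At (dual ?a)) TT)) (And (At ?a) (At (dual ?a)))"
    by (rule derivable_AndR, rule derivable_And_TT)
  also have "derivable K \<dots> FF" using derivable_rule[of "AiU ?a" K] assms(2) by simp
  finally show ?thesis using assms(1) Clash_Left by (simp add: clause_fm_def)
qed (simp_all add: clause_fm_def derivable_And_TT)

lemma clash_exists:
  assumes "\<not> jointly_sat F H" "c \<in> set (clauses F)" "d \<in> set (clauses H)"
  shows "\<exists>w. is_clash F H c d w"
proof (rule ccontr)
  assume "\<nexists>w. is_clash F H c d w"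
  then have n1: "\<forall>x\<in>set c. \<forall>x'\<in>set c. atom_at F x' \<noteq> dual (atom_at F x)"
    and n2: "\<forall>y\<in>set d. \<forall>y'\<in>set d. atom_at H y' \<noteq> dual (atom_at H y)"
    and n3: "\<forall>x\<in>set c. \<forall>y\<in>set d. atom_at H y \<noteq> dual (atom_at F x)"
    by (metis is_clash.simps)+
  then have n3': "\<forall>x\<in>set c. \<forall>y\<in>set d. atom_at F x \<noteq> dual (atom_at H y)"
    by (metis dual_dual)
  define pos_atoms where "pos_atoms = atom_at F ` set c \<union> atom_at H ` set d"
  define v where "v x = ((x, True) \<in> pos_atoms)" for x
  have consistent: "dual a \<notin> pos_atoms" if "a \<in> pos_atoms" for a
    using that n1 n2 n3 n3' unfolding pos_atoms_def by (auto simp: eq_commute[of "dual _"])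
  have true: "eval_atom v a" if "a \<in> pos_atoms" for a
  proof -
    obtain x b where "a = (x, b)" by fastforce
    then show ?thesis using consistent[OF that] that unfolding v_def by (cases b) (auto simp: dual_def)
  qed
  have "eval v F" using eval_clauses assms(2) true unfolding pos_atoms_def by blast
  moreover have "eval v H" using eval_clauses assms(3) true unfolding pos_atoms_def by blast
  ultimately show False using assms(1) unfolding jointly_sat_def by blast
qed

definition irredundant :: "'a fm \<Rightarrow> 'a fm \<Rightarrow> bool" where
  "irredundant F H \<longleftrightarrow> (\<forall>p\<in>atom_pos F. jointly_sat (coweaken F {p}) H)"

lemma ex_irredundant_coweakening:
  assumes "\<not> jointly_sat A G"
  shows "\<exists>F H. derivable {KAwU} A F \<and> derivable {KAwU} G H \<and>
    \<not> jointly_sat F H \<and> irredundant F H \<and> irredundant H F"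
  using assms
proof (induction "card (atom_pos A) + card (atom_pos G)" arbitrary: A G rule: less_induct)
  case less
  have fewer: "card (atom_pos (coweaken X {p})) < card (atom_pos X)" if "p \<in> atom_pos X" for X :: "'a fm" and p
    using that finite_atom_pos[of X] unfolding atom_pos_coweaken by (metis card_Diff1_less)
  consider "irredundant A G \<and> irredundant G A"
    | p where "p \<in> atom_pos A" "\<not> jointly_sat (coweaken A {p}) G"
    | p where "p \<in> atom_pos G" "\<not> jointly_sat A (coweaken G {p})"
    unfolding irredundant_def jointly_sat_sym[of _ A] by blast
  then show ?case
  proof cases
    case 1
    then show ?thesis using less.prems by (blast intro: derivable_refl)
  next
    case (2 p)
    then show ?thesis
      using less.hyps[of "coweaken A {p}" G] fewer
        derivable_trans[OF derivable_coweaken[of "{KAwU}" A "{p}"]] by fastforce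
  next
    case (3 p)
    then show ?thesis
      using less.hyps[of A "coweaken G {p}"] fewer
        derivable_trans[OF derivable_coweaken[of "{KAwU}" G "{p}"]] by fastforce
  qed
qed

lemma unclashed_pos_redundant:
  assumes W: "\<forall>c\<in>set (clauses F). \<forall>d\<in>set (clauses H). is_clash F H c d (W c d)"
    and p: "\<forall>c\<in>set (clauses F). \<forall>d\<in>set (clauses H). p \<notin> set (clash_pos (W c d))"
  shows "\<not> jointly_sat (coweaken F {p}) H"
proof
  assume "jointly_sat (coweaken F {p}) H"
  then obtain v c' d where "eval v (coweaken F {p})"
    and c': "c' \<in> set (clauses (coweaken F {p}))" "\<forall>q\<in>set c'. eval_atom v (atom_at (coweaken F {p}) q)"
    and d: "d \<in> set (clauses H)" "\<forall>y\<in>set d. eval_atom v (atom_at H y)"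
    unfolding jointly_sat_def eval_clauses by blast
  then obtain c where c: "c \<in> set (clauses F)" "c' = filter (\<lambda>q. q \<noteq> p) c"
    by (auto simp: clauses_coweaken)
  have c_true: "eval_atom v (atom_at F q)" if "q \<in> set c" "q \<noteq> p" for q
  proof -
    have "q \<in> atom_pos F - {p}" using that clauses_subset_atom_pos[OF c(1)] by auto
    then show ?thesis using that c c'(2) atom_at_coweaken[of q F "{p}"] by auto
  qed
  have clash: "is_clash F H c d (W c d)" "p \<notin> set (clash_pos (W c d))"
    using W p c d by auto
  show False
  proof (cases "W c d")
    case (Clash_Left x x')
    with clash have "x \<in> set c" "x' \<in> set c" "x \<noteq> p" "x' \<noteq> p" "atom_at F x' = dual (atom_at F x)"
      by auto
    then show False using c_true by (metis eval_atom_dual)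
  next
    case (Clash_Right y y')
    then show False using clash d(2) by (metis is_clash.simps(2) eval_atom_dual)
  next
    case (Clash_Cross x y)
    with clash have "x \<in> set c" "x \<noteq> p" "y \<in> set d" "atom_at H y = dual (atom_at F x)"
      by auto
    then show False using c_true d(2) by (metis eval_atom_dual)
  qed
qed

lemma derivable_clash_residues:
  assumes W: "\<forall>c\<in>set (clauses F). \<forall>d\<in>set (clauses H). is_clash F H c d (W c d)"
    and irr: "irredundant F H"
  shows "derivable {KAcU, KAiU} F
    (disjs (map (\<lambda>c. conjs (map (\<lambda>d. clash_residue F (W c d)) (clauses H))) (clauses F)))"
proof -
  define N where "N c = concat (map (\<lambda>d. clash_pos (W c d)) (clauses H))" for c
  have "clause_selection F (map N (clauses F))"
    unfolding clause_selection_def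
  proof
    show "list_all2 (\<lambda>c n. set n \<subseteq> set c) (clauses F) (map N (clauses F))"
      using W clash_pos_subset by (fastforce simp: list_all2_map2 list_all2_same N_def)
    show "\<forall>p\<in>atom_pos F. \<exists>n\<in>set (map N (clauses F)). p \<in> set n"
      using irr unclashed_pos_redundant[OF W] unfolding irredundant_def N_def by fastforce
  qed
  then have "derivable {KAcU, KAiU} F (disjs (map (clause_fm F) (map N (clauses F))))"
    by (rule cocontract_selection) simp
  also have "derivable {KAcU, KAiU} \<dots>
      (disjs (map (\<lambda>c. conjs (map (\<lambda>d. clash_residue F (W c d)) (clauses H))) (clauses F)))"
    unfolding map_map
  proof (rule disjs_map)
    fix c assume c: "c \<in> set (clauses F)"
    have "derivable {KAcU, KAiU} (clause_fm F (N c))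
        (conjs (map (clause_fm F) (map (\<lambda>d. clash_pos (W c d)) (clauses H))))"
      unfolding N_def by (rule clause_fm_concat)
    also have "derivable {KAcU, KAiU} \<dots> (conjs (map (\<lambda>d. clash_residue F (W c d)) (clauses H)))"
      unfolding map_map by (rule conjs_map) (use W c derivable_clash_residue in force)
    finally show "derivable {KAcU, KAiU} ((clause_fm F \<circ> N) c)
        (conjs (map (\<lambda>d. clash_residue F (W c d)) (clauses H)))" by simp
  qed
  finally show ?thesis .
qed

lemma clash_interpolant:
  assumes "\<not> jointly_sat F H" "irredundant F H" "irredundant H F"
  obtains M where "derivable {KAcU, KAiU} F M" "derivable {KAcD, KAiD} M (neg H)"
proof -
  define W where "W c d = (SOME w. is_clash F H c d w)" for c d
  have W: "\<forall>c\<in>set (clauses F). \<forall>d\<in>set (clauses H). is_clash F H c d (W c d)"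
    unfolding W_def using clash_exists[OF assms(1)] by (metis someI_ex)
  then have W': "\<forall>d\<in>set (clauses H). \<forall>c\<in>set (clauses F). is_clash H F d c (clash_swap (W c d))"
    using is_clash_swap by blast
  let ?M = "conjs (map (\<lambda>d. disjs (map (\<lambda>c. clash_residue F (W c d)) (clauses F))) (clauses H))"
  have "derivable {KAcU, KAiU} F
      (disjs (map (\<lambda>c. conjs (map (\<lambda>d. clash_residue F (W c d)) (clauses H))) (clauses F)))"
    by (rule derivable_clash_residues[OF W assms(2)])
  also have "derivable {KAcU, KAiU} \<dots> ?M" by (rule disjs_conjs_medial)
  finally have "derivable {KAcU, KAiU} F ?M" .
  moreover have "derivable {KAcD, KAiD} ?M (neg H)"
  proof -
    have "derivable {KAcU, KAiU} H
        (disjs (map (\<lambda>d. conjs (map (\<lambda>c. clash_residue H (clash_swap (W c d))) (clauses F))) (clauses H)))"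
      by (rule derivable_clash_residues[OF W' assms(3)])
    moreover have "neg (disjs (map (\<lambda>d. conjs (map (\<lambda>c. clash_residue H (clash_swap (W c d)))
        (clauses F))) (clauses H))) = ?M"
      unfolding neg_disjs map_map comp_def neg_conjs
      using W neg_clash_residue_swap
      by (intro arg_cong[where f=conjs] map_cong refl arg_cong[where f=disjs]) force
    ultimately show ?thesis
      using derivable_dual by fastforce
  qed
  ultimately show thesis by (rule that)
qed

theorem theorem5p25:
  fixes A B :: "'a fm" and \<Phi> :: "'a step list"
  assumes "derivation A \<Phi> B"
  shows "\<exists>\<Psi>. derivation A \<Psi> B \<and> super_streamlined \<Psi> B"
proof -
  have "\<not> jointly_sat A (neg B)"
    using derivation_sound[OF assms] unfolding jointly_sat_def by auto
  then obtain F H where AF: "derivable {KAwU} A F" and BH: "derivable {KAwU} (neg B) H"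
    and clash: "\<not> jointly_sat F H" "irredundant F H" "irredundant H F"
    using ex_irredundant_coweakening by blast
  obtain M where "derivable {KAcU, KAiU} F M" "derivable {KAcD, KAiD} M (neg H)"
    using clash_interpolant[OF clash] .
  moreover have "derivable {KAwD} (neg H) B"
    using derivable_dual[OF BH] by simp
  ultimately show ?thesis
    using super_streamlined_phases[OF AF] by blast
qed

end
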